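(* For any $\varepsilon>0$, the set $$M_\varepsilon=\{m\in\mathbb{N} : |A|\leq m^{\varepsilon}\text{ for every } A\subset\mathbb{Z}_m \text{ with } (A-A)\cap R_m=\{0\}\}$$ has positive density.
   Context: $\mathbb{Z}_m$ is the ring of integers modulo $m$; $R_m=\{a^2 : a\in\mathbb{Z}_m\}$ is the set of all squares in $\mathbb{Z}_m$ (including $0$ and squares that are not units); $A-A=\{a-b : a,b\in A\}$. The density of $M\subseteq\mathbb{N}$ means the lower asymptotic density $\liminf_{N\to\infty}\frac{\#(M\cap\{1,\dots,N\})}{N}$. *)

theory Defs
  imports "HOL-Analysis.Analysis" "HOL-Number_Theory.Residues"
begin

definition lower_density :: "nat set \<Rightarrow> ereal" where
  "lower_density M = liminf (\<lambda>N. ereal (real (card (M \<inter> {1..N})) / real N))"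

definition squares :: "('a, 'b) ring_scheme \<Rightarrow> 'a set" where
  "squares R = {a \<otimes>\<^bsub>R\<^esub> a | a. a \<in> carrier R}"

definition difference_set :: "('a, 'b) ring_scheme \<Rightarrow> 'a set \<Rightarrow> 'a set" where
  "difference_set R A = {a \<ominus>\<^bsub>R\<^esub> b | a b. a \<in> A \<and> b \<in> A}"

(* The modulus is positive: residue_ring 0 has an empty carrier and is not the ring of integers.
   For m = 1 the ring residue_ring 1 has carrier {0} and the operations of the zero ring on it;
   only its field "one", which is not used here, lies outside the carrier. *)
definition M_set :: "real \<Rightarrow> nat set" where
  "M_set \<epsilon> = {m. m > 0 \<and>
     (\<forall>A. A \<subseteq> carrier (residue_ring (int m)) \<longrightarrow>
        difference_set (residue_ring (int m)) A \<inter> squares (residue_ring (int m))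
          = {\<zero>\<^bsub>residue_ring (int m)\<^esub>} \<longrightarrow>
        real (card A) \<le> real m powr \<epsilon>)}"

end

theory Submission
  imports Defs "HOL-Number_Theory.Prime_Powers"
begin

text \<open>
  Let \<open>p\<close> be a prime with \<open>p mod 4 = 3\<close> that divides \<open>m\<close> exactly once, and let \<open>n = m / p\<close>. Since \<open>- 1\<close>
  is not a square modulo \<open>p\<close>, one of \<open>d\<close> and \<open>- d\<close> is a square modulo \<open>p\<close> for every \<open>d\<close>. If two distinct
  elements of \<open>A\<close> agree modulo \<open>n\<close>, their difference is \<open>0\<close> modulo \<open>n\<close>, so in one of the two orders it
  is a nonzero square modulo \<open>m\<close>. Hence a set without nonzero square differences has at most \<open>n\<close>
  elements (\<open>card_le_cofactor_if_no_square_difference\<close>). When \<open>p\<close> is at least \<open>m powr (1 - \<delta>)\<close>, this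
  bound is at most \<open>m powr \<delta>\<close>. It therefore suffices to show that a positive proportion of the integers
  up to \<open>N\<close> has a prime factor \<open>p > N powr (1 - \<delta>)\<close> in the residue class \<open>3\<close> modulo \<open>4\<close>.

  For \<open>\<delta> \<le> 1 / 2\<close> no integer up to \<open>N\<close> has two such prime factors, so the number of these integers is
  the sum of \<open>N div p \<ge> N / (2 p)\<close> over the admissible \<open>p\<close>. What remains is a lower bound, independent
  of \<open>N\<close>, for the sum of \<open>1 / p\<close> over the primes \<open>p\<close> in the class \<open>3\<close> modulo \<open>4\<close> between
  \<open>N powr (1 - \<delta>)\<close> and \<open>N\<close>.

  That bound follows from Mertens' theorem for the modulus \<open>4\<close>: up to \<open>x\<close>, the sum of \<open>ln p / p\<close> over
  the primes \<open>p\<close> in the class \<open>3\<close> is \<open>ln x / 2\<close> up to a bounded error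
  (\<open>sum_ln_over_p_window_ge\<close> is the form used here). Its ingredients are Mertens' estimate for the
  von Mangoldt function \<open>\<Lambda>\<close> (\<open>sum_mangoldt_over_n_bounds\<close>), obtained from the size of \<open>ln N!\<close> and
  Chebyshev's upper bound, and the boundedness of the sums of \<open>\<chi> n * \<Lambda> n / n\<close> for the nontrivial
  character \<open>\<chi>\<close> modulo \<open>4\<close> (\<open>abs_sum_chi4_mangoldt_over_n_le\<close>), which rests on \<open>L(1, \<chi>) \<noteq> 0\<close>.
  Nonvanishing is immediate for this character, because \<open>1 - 1/3 + 1/5 - \<dots>\<close> is an alternating series.
\<close>

section \<open>Sets without square differences when the modulus has a large prime factor\<close>

text \<open>
  The power \<open>u = d ^ ((p - 1) / 2)\<close> squares to \<open>1\<close> by Fermat's theorem, so it is \<open>1\<close> or \<open>- 1\<close>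
  modulo \<open>p\<close>, and \<open>(d ^ (k + 1))\<^sup>2 = d * u\<close> because \<open>(p - 1) / 2 = 2 * k + 1\<close>. Using a power of \<open>d\<close> as the
  square root has the advantage that it keeps every divisor of \<open>d\<close>.
\<close>

lemma pow_squared_eq_self_or_neg_mod_prime:
  fixes d :: int
  assumes "prime p" "p = 4 * k + 3" "\<not> int p dvd d"
  shows "int p dvd (d ^ (k + 1))\<^sup>2 - d \<or> int p dvd (d ^ (k + 1))\<^sup>2 + d"
proof -
  interpret residues_prime p "residue_ring (int p)"
    by unfold_locales (use assms in auto)
  define u where "u = d ^ (2 * k + 1)"
  have "coprime d (int p)"
    using assms p_coprime_right_int by blast
  hence "[d ^ totient (nat (int p)) = 1] (mod int p)"
    by (rule euler_theorem)
  moreover have "totient (nat (int p)) = (2 * k + 1) * 2"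
    unfolding nat_int totient_prime[OF assms(1)] using assms(2) by simp
  ultimately have "[u ^ 2 = 1] (mod int p)"
    unfolding u_def power_mult[symmetric] by simp
  hence "int p dvd (u - 1) * (u + 1)"
    by (simp add: cong_iff_dvd_diff power2_eq_square algebra_simps)
  moreover have "prime (int p)"
    using assms(1) by simp
  ultimately have "int p dvd u - 1 \<or> int p dvd u + 1"
    by (simp add: prime_dvd_mult_iff)
  moreover have "(d ^ (k + 1))\<^sup>2 - d = d * (u - 1)" "(d ^ (k + 1))\<^sup>2 + d = d * (u + 1)"
    by (simp_all add: u_def algebra_simps power2_eq_square flip: power_add mult_2)
  ultimately show ?thesis
    by auto
qed

text \<open>
  Reduction modulo \<open>n\<close> is injective on \<open>A\<close>. If \<open>n\<close> divides \<open>d = x - y\<close>, then it also divides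
  the power \<open>t\<close> of \<open>d\<close> whose square is \<open>d\<close> or \<open>- d\<close> modulo \<open>p\<close>. So \<open>t\<^sup>2\<close> is \<open>d\<close> or \<open>- d\<close> modulo both
  coprime factors of \<open>p * n\<close>.
\<close>

lemma card_le_cofactor_if_no_square_difference:
  fixes A :: "int set"
  assumes p: "prime p" "p mod 4 = 3" and "n > 0" and "\<not> p dvd n"
  defines "R \<equiv> residue_ring (int (p * n))"
  assumes A: "A \<subseteq> carrier R" "difference_set R A \<inter> squares R = {\<zero>\<^bsub>R\<^esub>}"
  shows "card A \<le> n"
proof -
  define m where "m = int (p * n)"
  have "1 < m"
    using prime_gt_1_nat[OF p(1)] assms(3) less_le_trans[of 1 p "p * n"] by (simp add: m_def flip: of_nat_mult)
  then interpret residues m R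
    by unfold_locales (auto simp: R_def m_def)
  have cop: "coprime (int p) (int n)"
    using p assms(4) prime_imp_coprime by (simp add: coprime_int_iff) blast
  have p3: "p = 4 * (p div 4) + 3"
    using p(2) by presburger
  have squares: "(t\<^sup>2) mod m \<in> squares R" for t
    unfolding squares_def using mult_cong[of t t] by (auto simp: power2_eq_square intro!: exI[of _ "t mod m"])
  have reduced: "x mod m = x" if "x \<in> A" for x
    using A(1) that by (auto simp: res_carrier_eq)
  have differences: "(x - y) mod m \<in> difference_set R A" if "x \<in> A" "y \<in> A" for x y
  proof -
    have "x \<ominus>\<^bsub>R\<^esub> y = (x - y) mod m"
      using add_cong[of x "-y"] neg_cong[of y] that by (simp add: a_minus_def reduced)
    thus ?thesis
      using that unfolding difference_set_def by (metis (mono_tags, lifting) mem_Collect_eq)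
  qed
  have "inj_on (\<lambda>x. x mod int n) A"
  proof (rule inj_onI)
    fix x y assume xy: "x \<in> A" "y \<in> A" "x mod int n = y mod int n"
    define t where "t = (x - y) ^ (p div 4 + 1)"
    have n: "int n dvd x - y"
      using xy by (simp add: mod_eq_dvd_iff)
    show "x = y"
    proof (cases "int p dvd x - y")
      case True
      hence "m dvd x - y"
        unfolding m_def using n cop by (simp add: divides_mult)
      hence "x mod m = y mod m"
        by (simp add: mod_eq_dvd_iff)
      thus ?thesis
        using xy by (simp add: reduced)
    next
      case False
      have "\<not> m dvd x - y"
        using False by (auto simp: m_def)
      hence nz: "(x - y) mod m \<noteq> 0" "(y - x) mod m \<noteq> 0"
        by (auto simp: mod_eq_0_iff_dvd dvd_diff_commute)
      have nt: "int n dvd t\<^sup>2"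
        using n by (simp add: t_def power2_eq_square)
      from pow_squared_eq_self_or_neg_mod_prime[OF p(1) p3 False]
      have "int p dvd t\<^sup>2 - (x - y) \<or> int p dvd t\<^sup>2 + (x - y)"
        by (simp add: t_def)
      hence "m dvd t\<^sup>2 - (x - y) \<or> m dvd t\<^sup>2 + (x - y)"
        using divides_mult[OF _ _ cop] n nt by (auto simp: m_def)
      hence "t\<^sup>2 mod m = (x - y) mod m \<or> t\<^sup>2 mod m = (y - x) mod m"
        by (auto simp: mod_eq_dvd_iff algebra_simps)
      hence "\<exists>z\<in>difference_set R A \<inter> squares R. z \<noteq> 0"
        using squares[of t] differences[OF xy(1,2)] differences[OF xy(2,1)] nz by auto
      thus ?thesis
        using A(2) by (simp add: zero_cong)
    qed
  qed
  moreover have "(\<lambda>x. x mod int n) ` A \<subseteq> {0..<int n}"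
    using assms(3) by auto
  ultimately have "card A \<le> card {0..<int n}"
    by (intro card_inj_on_le) auto
  thus ?thesis
    by simp
qed

text \<open>
  The hypothesis \<open>m < p\<^sup>2\<close> makes \<open>p\<close> coprime to \<open>m / p\<close>, and the lower bound on \<open>p\<close> makes the
  cofactor \<open>m / p\<close> at most \<open>m powr \<delta>\<close>.
\<close>

lemma mem_M_setI:
  assumes p: "prime p" "p mod 4 = 3" and "p dvd m" "m > 0"
    and large: "real p \<ge> real m powr (1 - \<delta>)" "m < p\<^sup>2" and "\<delta> \<le> \<epsilon>"
  shows "m \<in> M_set \<epsilon>"
proof -
  obtain n where m: "m = p * n"
    using assms by blast
  have n: "n > 0" "\<not> p dvd n"
    using assms by (auto simp: m power2_eq_square dest: dvd_imp_le)
  have "real n = real m / real p"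
    using p(1) by (simp add: m prime_gt_0_nat)
  also have "\<dots> \<le> real m / (real m powr (1 - \<delta>))"
    using large assms by (intro divide_left_mono) (auto simp: prime_gt_0_nat)
  also have "\<dots> = real m powr \<delta>"
    using \<open>m > 0\<close> by (simp add: powr_diff)
  also have "\<dots> \<le> real m powr \<epsilon>"
    using assms by (intro powr_mono) auto
  finally have n_le: "real n \<le> real m powr \<epsilon>" .
  have "real (card A) \<le> real m powr \<epsilon>"
    if "A \<subseteq> carrier (residue_ring (int m))"
      "difference_set (residue_ring (int m)) A \<inter> squares (residue_ring (int m))
          = {\<zero>\<^bsub>residue_ring (int m)\<^esub>}" for A
  proof -
    have "card A \<le> n"
      using card_le_cofactor_if_no_square_difference[OF p n] that unfolding m by blast
    thus ?thesis
      using n_le by linarith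
  qed
  thus ?thesis
    using \<open>m > 0\<close> unfolding M_set_def by blast
qed

section \<open>The estimates of Chebyshev and Mertens\<close>

text \<open>
  Both sides run over the pairs \<open>(d, k)\<close> with \<open>d * k \<le> N\<close>.
\<close>

lemma sum_divisors_eq_sum_cofactors:
  fixes g :: "nat \<Rightarrow> nat \<Rightarrow> 'a :: comm_monoid_add"
  shows "(\<Sum>n\<in>{1..N}. \<Sum>d | d dvd n. g d (n div d)) = (\<Sum>d\<in>{1..N}. \<Sum>k\<in>{1..N div d}. g d k)"
proof -
  have "(\<Sum>n\<in>{1..N}. \<Sum>d | d dvd n. g d (n div d))
      = (\<Sum>(n, d)\<in>(SIGMA n:{1..N}. {d. d dvd n}). g d (n div d))"
    by (rule sum.Sigma) auto
  also have "\<dots> = (\<Sum>(d, k)\<in>(SIGMA d:{1..N}. {1..N div d}). g d k)"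
  proof (rule sum.reindex_bij_witness[where i = "\<lambda>(d, k). (d * k, d)" and j = "\<lambda>(n, d). (d, n div d)"])
    fix a assume "a \<in> (SIGMA n:{1..N}. {d. d dvd n})"
    then obtain n d where a: "a = (n, d)" "1 \<le> n" "n \<le> N" "d dvd n"
      by auto
    hence "1 \<le> d" "d \<le> n"
      by (auto simp: Suc_le_eq dvd_imp_le intro: dvd_pos_nat)
    thus "(\<lambda>(n, d). (d, n div d)) a \<in> (SIGMA d:{1..N}. {1..N div d})"
      using a by (auto simp: Suc_le_eq div_greater_zero_iff intro: div_le_mono)
  next
    fix b assume "b \<in> (SIGMA d:{1..N}. {1..N div d})"
    then obtain d k where b: "b = (d, k)" "1 \<le> d" "1 \<le> k" "k \<le> N div d"
      by auto
    hence "d * k \<le> N"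
      by (metis less_eq_div_iff_mult_less_eq mult.commute less_eq_Suc_le One_nat_def)
    thus "(\<lambda>(d, k). (d * k, d)) b \<in> (SIGMA n:{1..N}. {d. d dvd n})"
      using b by (simp add: Suc_le_eq)
  qed auto
  also have "\<dots> = (\<Sum>d\<in>{1..N}. \<Sum>k\<in>{1..N div d}. g d k)"
    by (rule sum.Sigma[symmetric]) auto
  finally show ?thesis .
qed

lemma ln_fact_eq_sum_ln: "ln (fact N) = (\<Sum>n\<in>{1..N}. ln (real n))"
  by (induction N) (simp_all add: ln_mult)

text \<open>
  Legendre's formula for \<open>N!\<close>, from \<open>ln n\<close> being the sum of \<open>\<Lambda> d\<close> over the divisors of \<open>n\<close>.
\<close>

lemma ln_fact_eq_sum_mangoldt:
  "ln (fact N) = (\<Sum>d\<in>{1..N}. mangoldt d * real (N div d))"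
proof -
  have "ln (fact N) = (\<Sum>n\<in>{1..N}. \<Sum>d | d dvd n. (mangoldt d :: real))"
    unfolding ln_fact_eq_sum_ln by (intro sum.cong refl) (simp add: mangoldt_sum)
  also have "\<dots> = (\<Sum>d\<in>{1..N}. \<Sum>k\<in>{1..N div d}. mangoldt d)"
    by (rule sum_divisors_eq_sum_cofactors)
  finally show ?thesis
    by (simp add: mult.commute)
qed

lemma ln_fact_ge: "real N * ln (real N) - real N \<le> ln (fact N)"
proof (induction N)
  case (Suc N)
  show ?case
  proof (cases "N = 0")
    case False
    have "ln (real (Suc N) / real N) \<le> real (Suc N) / real N - 1"
      using False by (intro ln_le_minus_one) auto
    hence "ln (real (Suc N)) - ln (real N) \<le> 1 / real N"
      using False by (simp add: ln_div field_simps)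
    hence "real N * (ln (real (Suc N)) - ln (real N)) \<le> 1"
      using False by (simp add: field_simps)
    moreover have "ln (fact (Suc N) :: real) = ln (real (Suc N)) + ln (fact N)"
      by (simp add: ln_mult)
    ultimately show ?thesis
      using Suc.IH by (simp add: algebra_simps del: fact_Suc)
  qed auto
qed auto

lemma ln_fact_le: "ln (fact N) \<le> real N * ln (real N)"
proof (cases "N = 0")
  case False
  have "ln (fact N :: real) \<le> ln (real (N ^ N))"
    using fact_le_power[of N, where ?'a = real] False by (subst ln_le_cancel_iff) auto
  thus ?thesis
    using False by (simp add: ln_realpow)
qed auto

text \<open>
  Chebyshev's argument: each \<open>d\<close> with \<open>n < d \<le> 2 * n\<close> enters the expansion of the logarithm of the
  central binomial coefficient with weight \<open>1\<close>, every other \<open>d\<close> with weight \<open>0\<close> or \<open>1\<close>, and the coefficient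
  is at most \<open>2 ^ (2 * n)\<close>.
\<close>

lemma sum_mangoldt_dyadic_le:
  "(\<Sum>d\<in>{n<..2 * n}. mangoldt d :: real) \<le> 2 * real n * ln 2"
proof -
  have "(\<Sum>d\<in>{n<..2 * n}. mangoldt d :: real)
      = (\<Sum>d\<in>{1..2 * n}. if n < d then mangoldt d else 0)"
    by (rule sum.mono_neutral_cong_left) auto
  also have "\<dots> \<le> (\<Sum>d\<in>{1..2 * n}. mangoldt d * (real (2 * n div d) - 2 * real (n div d)))"
  proof (rule sum_mono)
    fix d assume d: "d \<in> {1..2 * n}"
    have "2 * (n div d) \<le> 2 * n div d"
      using d by (subst less_eq_div_iff_mult_less_eq) (auto simp: mult.assoc)
    hence "0 \<le> real (2 * n div d) - 2 * real (n div d)"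
      by linarith
    moreover have "2 * n div d \<ge> 1"
      using d by (subst less_eq_div_iff_mult_less_eq) auto
    hence "1 \<le> real (2 * n div d) - 2 * real (n div d)" if "n < d"
      using that by simp
    ultimately show "(if n < d then mangoldt d else 0)
        \<le> mangoldt d * (real (2 * n div d) - 2 * real (n div d))"
      using mangoldt_nonneg[of d] mult_left_mono[of 1 "real (2 * n div d) - 2 * real (n div d)" "mangoldt d"]
      by (cases "n < d") simp_all
  qed
  also have "\<dots> = ln (fact (2 * n)) - 2 * (\<Sum>d\<in>{1..2 * n}. mangoldt d * real (n div d))"
    by (simp add: ln_fact_eq_sum_mangoldt sum_subtractf sum_distrib_left algebra_simps)
  also have "(\<Sum>d\<in>{1..2 * n}. mangoldt d * real (n div d)) = ln (fact n)"
    unfolding ln_fact_eq_sum_mangoldt by (rule sum.mono_neutral_right) auto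
  also have "ln (fact (2 * n)) - 2 * ln (fact n) = ln (real (2 * n choose n))"
  proof -
    have "(fact (2 * n) :: real) = fact n * fact n * real (2 * n choose n)"
      using binomial_fact_lemma[of n "2 * n"] by (metis add_diff_cancel_left' le_add1 mult_2 of_nat_fact of_nat_mult)
    moreover have "real (2 * n choose n) > 0"
      by simp
    ultimately show ?thesis
      by (simp only: ln_mult_pos fact_gt_zero mult_pos_pos)
  qed
  also have "\<dots> \<le> ln (real (2 ^ (2 * n)))"
    using binomial_le_pow2[of "2 * n" n] zero_less_binomial[of n "2 * n"]
    by (subst ln_le_cancel_iff) (auto simp del: of_nat_power)
  also have "\<dots> = 2 * real n * ln 2"
    by (simp add: ln_realpow)
  finally show ?thesis .
qed

text \<open>
  Halving the range repeatedly: \<open>\<psi>(2 k) \<le> \<psi>(k) + 2 k ln 2 \<le> 6 k\<close>, where \<open>\<psi>\<close> is Chebyshev's function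
  and \<open>2 * k\<close> exceeds \<open>n\<close> by at most one. The slack between \<open>3\<close> and \<open>4\<close> absorbs this rounding.
\<close>

lemma sum_mangoldt_le: "(\<Sum>d\<in>{1..n}. mangoldt d :: real) \<le> 4 * real n"
proof (induction n rule: less_induct)
  case (less n)
  have double: "(\<Sum>d\<in>{1..2 * k}. mangoldt d :: real) \<le> 6 * real k" if "k < n" for k
  proof -
    have "{1..2 * k} = {1..k} \<union> {k<..2 * k}"
      by auto
    hence "(\<Sum>d\<in>{1..2 * k}. mangoldt d :: real)
        = (\<Sum>d\<in>{1..k}. mangoldt d) + (\<Sum>d\<in>{k<..2 * k}. mangoldt d)"
      by (simp only:) (rule sum.union_disjoint, auto)
    also have "\<dots> \<le> 4 * real k + 2 * real k * 1"
      using less.IH[OF that] sum_mangoldt_dyadic_le[of k] mult_left_mono[of "ln 2" 1 "2 * real k"]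
        ln_le_minus_one[of "2 :: real"] by simp
    finally show ?thesis by simp
  qed
  show ?case
  proof (cases "n \<le> 2")
    case True
    have "{1..2} = {1, 2 :: nat}"
      by auto
    hence "(\<Sum>d\<in>{1..2}. mangoldt d :: real) \<le> 1"
      using ln_le_minus_one[of "2 :: real"] by simp
    moreover have "n = 0 \<or> n = 1 \<or> n = 2"
      using True by auto
    ultimately show ?thesis
      by auto
  next
    case False
    \<comment> \<open>The least \<open>k\<close> with \<open>n \<le> 2 * k\<close>.\<close>
    define k where "k = (n + 1) div 2"
    have k: "k < n" "n \<le> 2 * k" "2 * k \<le> n + 1"
      using False by (auto simp: k_def)
    have "(\<Sum>d\<in>{1..n}. mangoldt d :: real) \<le> (\<Sum>d\<in>{1..2 * k}. mangoldt d)"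
      using k by (intro sum_mono2) (auto simp: mangoldt_nonneg)
    also have "\<dots> \<le> 6 * real k"
      using k by (intro double) auto
    also have "\<dots> \<le> 4 * real n"
      using k False by linarith
    finally show ?thesis .
  qed
qed

text \<open>
  Replacing \<open>N div d\<close> by \<open>N / d\<close> in Legendre's formula costs at most \<open>\<psi>(N) \<le> 4 * N\<close>, and
  \<open>ln N!\<close> is \<open>N ln N\<close> with an error of at most \<open>N\<close>.
\<close>

lemma sum_mangoldt_over_n_bounds:
  assumes "N > 0"
  shows "ln (real N) - 1 \<le> (\<Sum>d\<in>{1..N}. mangoldt d / real d)"
    and "(\<Sum>d\<in>{1..N}. mangoldt d / real d) \<le> ln (real N) + 4"
proof -
  have frac: "real N / real d - 1 \<le> real (N div d)" "real (N div d) \<le> real N / real d" for d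
  proof -
    have "real (N div d) = of_int \<lfloor>real N / real d\<rfloor>"
      by (simp add: floor_divide_of_nat_eq)
    thus "real N / real d - 1 \<le> real (N div d)" "real (N div d) \<le> real N / real d"
      by linarith+
  qed
  have "real N * (ln (real N) - 1) \<le> (\<Sum>d\<in>{1..N}. mangoldt d * real (N div d))"
    using ln_fact_ge[of N] by (simp add: ln_fact_eq_sum_mangoldt algebra_simps)
  also have "\<dots> \<le> (\<Sum>d\<in>{1..N}. mangoldt d * (real N / real d))"
    by (intro sum_mono mult_left_mono frac mangoldt_nonneg)
  also have "\<dots> = real N * (\<Sum>d\<in>{1..N}. mangoldt d / real d)"
    by (simp add: sum_distrib_left mult_ac)
  finally show "ln (real N) - 1 \<le> (\<Sum>d\<in>{1..N}. mangoldt d / real d)"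
    using assms by simp
  have "real N * (\<Sum>d\<in>{1..N}. mangoldt d / real d) - (\<Sum>d\<in>{1..N}. mangoldt d)
      = (\<Sum>d\<in>{1..N}. mangoldt d * (real N / real d - 1))"
    by (simp add: sum_distrib_left mult_ac sum_subtractf right_diff_distrib)
  also have "\<dots> \<le> (\<Sum>d\<in>{1..N}. mangoldt d * real (N div d))"
    by (intro sum_mono mult_left_mono frac mangoldt_nonneg)
  also have "\<dots> \<le> real N * ln (real N)"
    using ln_fact_le[of N] by (simp add: ln_fact_eq_sum_mangoldt)
  finally have "real N * (\<Sum>d\<in>{1..N}. mangoldt d / real d) \<le> real N * (ln (real N) + 4)"
    using sum_mangoldt_le[of N] by (simp add: algebra_simps)
  thus "(\<Sum>d\<in>{1..N}. mangoldt d / real d) \<le> ln (real N) + 4"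
    using assms by simp
qed

section \<open>The nontrivial character modulo four\<close>

definition chi4 :: "nat \<Rightarrow> real" where
  "chi4 n = (if n mod 4 = 1 then 1 else if n mod 4 = 3 then -1 else 0)"

lemma chi4_mult: "chi4 (a * b) = chi4 a * chi4 b"
proof -
  have residues: "chi4 (r * s) = chi4 r * chi4 s" if "r \<in> {0, 1, 2, 3}" "s \<in> {0, 1, 2, 3}" for r s
    using that by (auto simp: chi4_def)
  have "chi4 ((a mod 4) * (b mod 4)) = chi4 (a mod 4) * chi4 (b mod 4)"
    by (intro residues) auto
  moreover have "chi4 (n mod 4) = chi4 n" for n
    by (simp add: chi4_def)
  moreover have "chi4 ((a mod 4) * (b mod 4)) = chi4 (a * b)"
    unfolding chi4_def mod_mult_eq ..
  ultimately show ?thesis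
    by simp
qed

lemma chi4_even: "even n \<Longrightarrow> chi4 n = 0"
proof -
  assume "even n"
  hence "n mod 4 \<noteq> 1 \<and> n mod 4 \<noteq> 3"
    by presburger
  thus ?thesis by (simp add: chi4_def)
qed

lemma chi4_odd: "odd n \<Longrightarrow> chi4 n = 1 \<or> chi4 n = -1"
proof -
  assume "odd n"
  hence "n mod 4 = 1 \<or> n mod 4 = 3"
    by presburger
  thus ?thesis by (auto simp: chi4_def)
qed

lemma abs_chi4_le: "\<bar>chi4 n\<bar> \<le> 1"
  by (simp add: chi4_def)

text \<open>
  Over the odd integers the character alternates in sign, so these are the usual bounds for an
  alternating sum with decreasing terms. Multiplying by \<open>chi4 m\<close> makes the first term positive.
\<close>

lemma chi4_sum_from_odd_bounds:
  fixes a :: "nat \<Rightarrow> real"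
  assumes "odd m"
    and "\<And>i j. m \<le> i \<Longrightarrow> i \<le> j \<Longrightarrow> a j \<le> a i" "\<And>i. m \<le> i \<Longrightarrow> 0 \<le> a i"
  shows "0 \<le> chi4 m * (\<Sum>n\<in>{m..<m + k}. chi4 n * a n)"
    and "chi4 m * (\<Sum>n\<in>{m..<m + k}. chi4 n * a n) \<le> a m"
proof -
  have "0 \<le> chi4 m * (\<Sum>n\<in>{m..<m + k}. chi4 n * a n)
      \<and> chi4 m * (\<Sum>n\<in>{m..<m + k}. chi4 n * a n) \<le> a m"
    using assms
  proof (induction k arbitrary: m rule: nat_induct2)
    case 0
    thus ?case by simp
  next
    case 1
    have "chi4 m * chi4 m = 1"
      using chi4_odd[OF "1.prems"(1)] by auto
    moreover have "0 \<le> a m"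
      by (intro "1.prems") auto
    ultimately show ?case by (simp flip: mult.assoc)
  next
    case (step k)
    have chi: "chi4 m * chi4 m = 1" "chi4 (m + 1) = 0" "chi4 (m + 2) = - chi4 m"
    proof -
      have "m mod 4 = 1 \<and> (m + 2) mod 4 = 3 \<or> m mod 4 = 3 \<and> (m + 2) mod 4 = 1"
        using step.prems(1) by presburger
      thus "chi4 m * chi4 m = 1" "chi4 (m + 2) = - chi4 m"
        by (auto simp: chi4_def)
      show "chi4 (m + 1) = 0"
        using step.prems(1) by (intro chi4_even) simp
    qed
    define S where "S = (\<Sum>n\<in>{m + 2..<m + 2 + k}. chi4 n * a n)"
    have "{m..<m + (k + 2)} = insert m (insert (m + 1) {m + 2..<m + 2 + k})"
      by auto
    hence sum_eq: "(\<Sum>n\<in>{m..<m + (k + 2)}. chi4 n * a n) = chi4 m * a m + (chi4 (m + 1) * a (m + 1) + S)"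
      by (simp add: S_def)
    \<comment> \<open>The signs at \<open>m\<close> and \<open>m + 2\<close> are opposite, so the remaining sum enters with a minus sign.\<close>
    have "chi4 m * (\<Sum>n\<in>{m..<m + (k + 2)}. chi4 n * a n) = chi4 m * chi4 m * a m - chi4 (m + 2) * S"
      unfolding sum_eq chi(2,3) by (simp add: algebra_simps)
    hence "chi4 m * (\<Sum>n\<in>{m..<m + (k + 2)}. chi4 n * a n) = a m - chi4 (m + 2) * S"
      unfolding chi(1) by simp
    moreover have "0 \<le> chi4 (m + 2) * S \<and> chi4 (m + 2) * S \<le> a (m + 2)"
      unfolding S_def using step.prems by (intro step.IH) auto
    moreover have "a (m + 2) \<le> a m"
      by (intro step.prems) auto
    ultimately show ?case by linarith
  qed
  thus "0 \<le> chi4 m * (\<Sum>n\<in>{m..<m + k}. chi4 n * a n)"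
    "chi4 m * (\<Sum>n\<in>{m..<m + k}. chi4 n * a n) \<le> a m" by auto
qed

lemma abs_chi4_sum_le:
  fixes a :: "nat \<Rightarrow> real"
  assumes anti: "\<And>i j. m \<le> i \<Longrightarrow> i \<le> j \<Longrightarrow> a j \<le> a i" and nonneg: "\<And>i. m \<le> i \<Longrightarrow> 0 \<le> a i"
  shows "\<bar>\<Sum>n\<in>{m..<l}. chi4 n * a n\<bar> \<le> a m"
proof -
  have odd_case: "\<bar>\<Sum>n\<in>{i..<l}. chi4 n * a n\<bar> \<le> a i" if "odd i" "m \<le> i" for i
  proof (cases "i \<le> l")
    case True
    then obtain k where k: "l = i + k"
      using le_Suc_ex by blast
    have "chi4 i = 1 \<or> chi4 i = -1"
      using that(1) by (rule chi4_odd)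
    moreover have "0 \<le> chi4 i * (\<Sum>n\<in>{i..<i + k}. chi4 n * a n)"
        "chi4 i * (\<Sum>n\<in>{i..<i + k}. chi4 n * a n) \<le> a i"
      using that assms by (intro chi4_sum_from_odd_bounds; simp)+
    ultimately show ?thesis
      unfolding k by auto
  qed (use that nonneg in auto)
  show ?thesis
  proof (cases "odd m \<or> l \<le> m")
    case True
    thus ?thesis using odd_case[of m] nonneg[of m] by auto
  next
    case False
    hence "(\<Sum>n\<in>{m..<l}. chi4 n * a n) = chi4 m * a m + (\<Sum>n\<in>{Suc m..<l}. chi4 n * a n)"
      by (intro sum.atLeast_Suc_lessThan) auto
    moreover have "chi4 m = 0"
      using False by (simp add: chi4_even)
    moreover have "a (Suc m) \<le> a m"
      by (intro anti) auto
    ultimately show ?thesis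
      using odd_case[of "Suc m"] False by auto
  qed
qed

text \<open>
  The limit is \<open>L(1, \<chi>) = \<pi> / 4\<close>. The tail of an alternating series is at most its first term, which
  gives the rate of convergence, and applied to the tail after \<open>1\<close> it keeps the limit away from \<open>0\<close>.
\<close>

lemma chi4_series_limit:
  obtains L :: real where "2 / 3 \<le> L"
    and "\<And>k. \<bar>(\<Sum>j\<in>{1..k}. chi4 j / real j) - L\<bar> \<le> 1 / real (k + 1)"
proof -
  define T where "T = (\<lambda>k. \<Sum>j\<in>{1..k}. chi4 j / real j)"
  have tail: "\<bar>T l - T k\<bar> \<le> 1 / real (k + 1)" if "k \<le> l" for k l
  proof -
    have "{1..l} = {1..k} \<union> {k + 1..<l + 1}"
      using that by auto
    hence "T l = T k + (\<Sum>j\<in>{k + 1..<l + 1}. chi4 j / real j)"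
      unfolding T_def by (simp only:) (rule sum.union_disjoint, auto)
    moreover have "\<bar>\<Sum>j\<in>{k + 1..<l + 1}. chi4 j * (1 / real j)\<bar> \<le> 1 / real (k + 1)"
      by (rule abs_chi4_sum_le) (auto simp: field_simps)
    ultimately show ?thesis
      by simp
  qed
  have "Cauchy T"
  proof (rule metric_CauchyI)
    fix e :: real assume "e > 0"
    then obtain k where k: "inverse (real (Suc k)) < e / 2"
      using reals_Archimedean[of "e / 2"] by auto
    have "dist (T i) (T j) < e" if "i \<ge> k" "j \<ge> k" for i j
    proof -
      have "1 / real (k + 1) < e / 2"
        using k by (simp add: field_simps)
      thus ?thesis
        using tail[OF that(1)] tail[OF that(2)] unfolding dist_real_def by linarith
    qed
    thus "\<exists>M. \<forall>m\<ge>M. \<forall>n\<ge>M. dist (T m) (T n) < e"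
      by blast
  qed
  then obtain L where L: "T \<longlonglongrightarrow> L"
    using Cauchy_convergent_iff convergent_def by blast
  have close: "\<bar>T k - L\<bar> \<le> 1 / real (k + 1)" for k
  proof -
    have "(\<lambda>l. \<bar>T l - T k\<bar>) \<longlonglongrightarrow> \<bar>L - T k\<bar>"
      by (intro tendsto_intros L)
    moreover have "\<forall>\<^sub>F l in sequentially. \<bar>T l - T k\<bar> \<le> 1 / real (k + 1)"
      using eventually_ge_at_top[of k] by eventually_elim (rule tail)
    ultimately have "\<bar>L - T k\<bar> \<le> 1 / real (k + 1)"
      by (intro tendsto_upperbound) auto
    thus ?thesis by linarith
  qed
  have "{1..2} = {1, 2 :: nat}"
    by auto
  hence "T 2 = 1"
    by (simp add: T_def chi4_def)
  moreover have "\<bar>T 2 - L\<bar> \<le> 1 / 3"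
    using close[of 2] by simp
  ultimately have "2 / 3 \<le> L"
    by linarith
  with close show ?thesis
    using that unfolding T_def by blast
qed

text \<open>
  The function \<open>ln x / x\<close> decreases only from \<open>x = e\<close> on. The terms before \<open>3\<close> vanish, since
  \<open>ln 1 = 0\<close> and \<open>chi4 2 = 0\<close>.
\<close>

lemma abs_sum_chi4_ln_le: "\<bar>\<Sum>n\<in>{1..N}. chi4 n * (ln (real n) / real n)\<bar> \<le> 1"
proof -
  have "(\<Sum>n\<in>{1..N}. chi4 n * (ln (real n) / real n)) = (\<Sum>n\<in>{3..<N + 1}. chi4 n * (ln (real n) / real n))"
  proof (rule sum.mono_neutral_right)
    have "i = 1 \<or> i = 2" if "i \<in> {1..N} - {3..<N + 1}" for i
      using that by auto
    thus "\<forall>i\<in>{1..N} - {3..<N + 1}. chi4 i * (ln (real i) / real i) = 0"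
      by (auto simp: chi4_def)
  qed auto
  also have "\<bar>\<dots>\<bar> \<le> ln (real 3) / real 3"
  proof (rule abs_chi4_sum_le)
    fix i j :: nat assume "3 \<le> i" "i \<le> j"
    thus "ln (real j) / real j \<le> ln (real i) / real i"
      using exp_le by (intro ln_x_over_x_mono) auto
  qed auto
  also have "\<dots> \<le> 1"
    using ln_le_minus_one[of "3 :: real"] by simp
  finally show ?thesis .
qed

text \<open>
  Write \<open>S\<close> for the sum in question and \<open>T\<close> for the partial sums of the series for \<open>L = L(1, \<chi>)\<close>.
  Expanding \<open>ln n\<close> as a divisor sum of \<open>\<Lambda>\<close> turns the bounded sum of \<open>\<chi> n * ln n / n\<close> into the sum of
  \<open>(\<chi> d * \<Lambda> d / d) * T (N div d)\<close>. Replacing each \<open>T (N div d)\<close> by \<open>L\<close> gives \<open>L * S\<close> and changes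
  the factor by at most \<open>d / N\<close>, hence the sum by at most \<open>\<psi>(N) / N \<le> 4\<close>. So \<open>\<bar>L * S\<bar> \<le> 5\<close>, and \<open>L \<ge> 2 / 3\<close>.
\<close>

lemma abs_sum_chi4_mangoldt_over_n_le:
  "\<bar>\<Sum>d\<in>{1..N}. chi4 d * mangoldt d / real d\<bar> \<le> 8"
proof (cases "N = 0")
  case False
  define S where "S = (\<Sum>d\<in>{1..N}. chi4 d * mangoldt d / real d)"
  define T where "T = (\<lambda>k. \<Sum>j\<in>{1..k}. chi4 j / real j)"
  obtain L where L: "2 / 3 \<le> L" "\<And>k. \<bar>T k - L\<bar> \<le> 1 / real (k + 1)"
    unfolding T_def using chi4_series_limit by blast
  have "(\<Sum>n\<in>{1..N}. chi4 n * (ln (real n) / real n))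
      = (\<Sum>n\<in>{1..N}. \<Sum>d | d dvd n. chi4 d * mangoldt d / real d * (chi4 (n div d) / real (n div d)))"
  proof (intro sum.cong refl)
    fix n assume n: "n \<in> {1..N}"
    have "chi4 n * (ln (real n) / real n) = (\<Sum>d | d dvd n. mangoldt d * (chi4 n / real n))"
      using n mangoldt_sum[of n, where ?'a = real] unfolding sum_distrib_right[symmetric] by simp
    also have "\<dots> = (\<Sum>d | d dvd n. chi4 d * mangoldt d / real d * (chi4 (n div d) / real (n div d)))"
      by (intro sum.cong refl) (use n in \<open>auto simp: chi4_mult elim!: dvdE\<close>)
    finally show "chi4 n * (ln (real n) / real n)
      = (\<Sum>d | d dvd n. chi4 d * mangoldt d / real d * (chi4 (n div d) / real (n div d)))" .
  qed
  also have "\<dots> = (\<Sum>d\<in>{1..N}. chi4 d * mangoldt d / real d * T (N div d))"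
    unfolding T_def sum_distrib_left
    by (rule sum_divisors_eq_sum_cofactors[of "\<lambda>d k. chi4 d * mangoldt d / real d * (chi4 k / real k)"])
  finally have expand: "(\<Sum>n\<in>{1..N}. chi4 n * (ln (real n) / real n))
      = (\<Sum>d\<in>{1..N}. chi4 d * mangoldt d / real d * T (N div d))" .
  have "L * S = (\<Sum>n\<in>{1..N}. chi4 n * (ln (real n) / real n))
      - (\<Sum>d\<in>{1..N}. chi4 d * mangoldt d / real d * (T (N div d) - L))"
    unfolding expand S_def sum_distrib_left sum_subtractf[symmetric]
    by (intro sum.cong refl) (simp only: right_diff_distrib mult.commute[of L] diff_diff_eq2 add_diff_cancel_left')
  also have "\<bar>\<dots>\<bar> \<le> 1 + (\<Sum>d\<in>{1..N}. \<bar>chi4 d * mangoldt d / real d * (T (N div d) - L)\<bar>)"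
    using abs_sum_chi4_ln_le[of N] sum_abs[of "\<lambda>d. chi4 d * mangoldt d / real d * (T (N div d) - L)" "{1..N}"]
    by linarith
  also have "\<dots> \<le> 1 + (\<Sum>d\<in>{1..N}. mangoldt d / real N)"
  proof (intro add_left_mono sum_mono)
    fix d assume d: "d \<in> {1..N}"
    have "N < d * (N div d + 1)"
      using d by (metis Suc_eq_plus1 atLeastAtMost_iff dividend_less_times_div less_eq_Suc_le mult_Suc_right One_nat_def)
    hence "real N \<le> real d * real (N div d + 1)"
      unfolding of_nat_mult[symmetric] of_nat_le_iff by simp
    hence "1 / real (N div d + 1) \<le> real d / real N"
      using False by (simp add: field_simps)
    hence T: "\<bar>T (N div d) - L\<bar> \<le> real d / real N"
      using L(2)[of "N div d"] by linarith
    have "\<bar>chi4 d * mangoldt d / real d * (T (N div d) - L)\<bar>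
        = \<bar>chi4 d\<bar> * (mangoldt d / real d * \<bar>T (N div d) - L\<bar>)"
      by (simp add: abs_mult)
    also have "\<dots> \<le> 1 * (mangoldt d / real d * (real d / real N))"
      by (intro mult_mono abs_chi4_le mult_left_mono T) (auto simp: mangoldt_nonneg)
    also have "\<dots> = mangoldt d / real N"
      using d by simp
    finally show "\<bar>chi4 d * mangoldt d / real d * (T (N div d) - L)\<bar> \<le> mangoldt d / real N" .
  qed
  also have "\<dots> \<le> 5"
    using sum_mangoldt_le[of N] False by (simp add: sum_divide_distrib[symmetric] field_simps)
  finally have "L * \<bar>S\<bar> \<le> 5"
    using L(1) by (simp add: abs_mult)
  moreover have "2 / 3 * \<bar>S\<bar> \<le> L * \<bar>S\<bar>"
    using L(1) by (intro mult_right_mono) auto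
  ultimately show ?thesis
    unfolding S_def[symmetric] by linarith
qed auto

section \<open>Mertens' theorem for primes congruent to three modulo four\<close>

text \<open>
  Only the powers of \<open>2\<close> contribute, and they give a geometric series.
\<close>

lemma sum_mangoldt_over_n_even_le:
  "(\<Sum>n | n \<in> {1..N} \<and> even n. mangoldt n / real n) \<le> 1"
proof -
  have "(\<Sum>n | n \<in> {1..N} \<and> even n. mangoldt n / real n)
      = (\<Sum>n | n \<in> {1..N} \<and> even n \<and> primepow n. mangoldt n / real n)"
    by (rule sum.mono_neutral_right) (auto simp: mangoldt_def)
  also have "\<dots> \<le> (\<Sum>n\<in>(\<lambda>k. 2 ^ k) ` {1..N}. mangoldt n / real n)"
  proof (rule sum_mono2)
    show "{n. n \<in> {1..N} \<and> even n \<and> primepow n} \<subseteq> (\<lambda>k. 2 ^ k) ` {1..N}"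
    proof
      fix n assume "n \<in> {n. n \<in> {1..N} \<and> even n \<and> primepow n}"
      then obtain p k where n: "prime p" "k > 0" "n = p ^ k" "even n" "n \<le> N"
        by (auto simp: primepow_def)
      hence "2 dvd p"
        using prime_dvd_power[OF two_is_prime_nat, of p k] by simp
      hence "p = 2"
        using primes_dvd_imp_eq[OF two_is_prime_nat n(1)] by simp
      hence pow: "n = 2 ^ k"
        using n(3) by simp
      hence "k \<in> {1..N}"
        using n(2,5) less_exp[of k] by (simp only: atLeastAtMost_iff) linarith
      with pow show "n \<in> (\<lambda>k. 2 ^ k) ` {1..N}"
        by (rule image_eqI)
    qed
  qed (auto simp: mangoldt_nonneg)
  also have "\<dots> = (\<Sum>k\<in>{1..N}. mangoldt (2 ^ k) / real (2 ^ k))"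
    by (subst sum.reindex) (auto simp: inj_on_def)
  also have "\<dots> = (\<Sum>k\<in>{1..N}. ln 2 * (1 / 2 ^ k))"
    by (intro sum.cong refl) (simp add: mangoldt_primepow')
  also have "\<dots> = ln 2 * (\<Sum>k\<in>{1..N}. 1 / 2 ^ k)"
    by (rule sum_distrib_left[symmetric])
  also have "(\<Sum>k\<in>{1..N}. 1 / 2 ^ k :: real) = 1 - 1 / 2 ^ N"
  proof (induction N)
    case (Suc N)
    thus ?case
      by (simp add: field_simps)
  qed simp
  also have "ln 2 * (1 - 1 / 2 ^ N :: real) \<le> 1"
    using ln_le_minus_one[of "2 :: real"] by (intro mult_le_one) auto
  finally show ?thesis .
qed

text \<open>
  Comparison with the telescoping series of \<open>1 / (n * (n + 1))\<close>.
\<close>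

lemma sum_inverse_squares_le: "(\<Sum>q\<in>{2..N}. 1 / (real q)\<^sup>2) \<le> 1"
proof -
  have telescope: "(\<Sum>q\<in>{2..N}. 1 / (real q)\<^sup>2) \<le> 1 - 1 / real N" if "N > 0"
    using that
  proof (induction N rule: nat_induct_non_zero)
    case (Suc n)
    have "1 / (real (Suc n))\<^sup>2 \<le> 1 / (real n * real (Suc n))"
      using Suc.hyps by (intro divide_left_mono) (auto simp: power2_eq_square)
    also have "\<dots> = 1 / real n - 1 / real (Suc n)"
      using Suc.hyps by (simp add: field_simps)
    finally have "1 / (real (Suc n))\<^sup>2 \<le> 1 / real n - 1 / real (Suc n)" .
    moreover have "(\<Sum>q\<in>{2..Suc n}. 1 / (real q)\<^sup>2)
        = (\<Sum>q\<in>{2..n}. 1 / (real q)\<^sup>2) + 1 / (real (Suc n))\<^sup>2"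
      using Suc.hyps by simp
    ultimately show ?case
      using Suc.IH by linarith
  qed simp
  have "1 - 1 / real N \<le> 1"
    by simp
  show ?thesis
  proof (cases "N = 0")
    case False
    thus ?thesis
      using telescope \<open>1 - 1 / real N \<le> 1\<close> by linarith
  qed simp
qed

lemma square_mod_4_neq_3: "(x :: nat)\<^sup>2 mod 4 \<noteq> 3"
proof (cases "even x")
  case True
  then obtain y where "x = 2 * y"
    by (elim evenE)
  hence "x\<^sup>2 = 4 * y\<^sup>2"
    by (simp add: power_mult_distrib)
  thus ?thesis
    by simp
next
  case False
  then obtain y where "x = 2 * y + 1"
    by (elim oddE)
  hence "x\<^sup>2 = 4 * (y\<^sup>2 + y) + 1"
    by (simp add: power2_eq_square algebra_simps)
  thus ?thesis
    by presburger
qed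

text \<open>
  A prime power in the class \<open>3\<close> modulo \<open>4\<close> is not a square, so if it is not prime it is
  \<open>p ^ (2 * j + 1) = p * q\<^sup>2\<close> with \<open>q = p ^ j\<close> and \<open>j > 0\<close>. Then \<open>p\<close> is recovered from \<open>q\<close>, so the terms
  are indexed by \<open>q\<close>, and each is at most \<open>ln p / (p * q\<^sup>2) \<le> 1 / q\<^sup>2\<close>.
\<close>

lemma sum_mangoldt_over_n_odd_powers_le:
  "(\<Sum>n | n \<in> {1..N} \<and> n mod 4 = 3 \<and> \<not> prime n. mangoldt n / real n) \<le> 1"
proof -
  define Q where "Q = {q \<in> {2..N}. primepow q}"
  \<comment> \<open>On \<open>Q\<close> this is the map \<open>p ^ j \<mapsto> p ^ (2 * j + 1)\<close>.\<close>
  define f where "f = (\<lambda>q :: nat. aprimedivisor q * q\<^sup>2)"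
  have "(\<Sum>n | n \<in> {1..N} \<and> n mod 4 = 3 \<and> \<not> prime n. mangoldt n / real n)
      = (\<Sum>n | n \<in> {1..N} \<and> n mod 4 = 3 \<and> \<not> prime n \<and> primepow n. mangoldt n / real n)"
    by (rule sum.mono_neutral_right) (auto simp: mangoldt_def)
  also have "\<dots> \<le> (\<Sum>n\<in>f ` Q. mangoldt n / real n)"
  proof (rule sum_mono2)
    show "{n. n \<in> {1..N} \<and> n mod 4 = 3 \<and> \<not> prime n \<and> primepow n} \<subseteq> f ` Q"
    proof
      fix n assume "n \<in> {n. n \<in> {1..N} \<and> n mod 4 = 3 \<and> \<not> prime n \<and> primepow n}"
      then obtain p k where n: "prime p" "k > 0" "n = p ^ k" "n mod 4 = 3" "n \<le> N" "\<not> prime n"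
        by (auto simp: primepow_def)
      have "odd k"
      proof
        assume "even k"
        then obtain j where "n = (p ^ j)\<^sup>2"
          using n(3) by (metis dvd_def mult.commute power_mult)
        thus False
          using n(4) square_mod_4_neq_3 by blast
      qed
      then obtain j where j: "k = 2 * j + 1"
        by (elim oddE)
      have "j > 0"
        using n j by (cases j) auto
      have "p ^ j \<le> n"
        using power_increasing[of j k p] prime_ge_1_nat[OF n(1)] unfolding n(3) j by simp
      moreover have "p ^ j > 1"
        using \<open>j > 0\<close> n(1) prime_gt_1_nat[of p] by (intro one_less_power) auto
      ultimately have "p ^ j \<in> Q"
        using n(1,5) \<open>j > 0\<close> by (simp add: Q_def)
      moreover have "f (p ^ j) = n"
        unfolding n(3) j f_def aprimedivisor_prime_power[OF n(1) \<open>j > 0\<close>]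
        by (simp add: power_even_eq)
      ultimately show "n \<in> f ` Q"
        by blast
    qed
  qed (auto simp: mangoldt_nonneg Q_def)
  also have "\<dots> \<le> (\<Sum>q\<in>Q. mangoldt (f q) / real (f q))"
    using sum_image_le[of Q "\<lambda>n. mangoldt n / real n" f] by (simp add: o_def mangoldt_nonneg Q_def)
  also have "\<dots> \<le> (\<Sum>q\<in>Q. 1 / (real q)\<^sup>2)"
  proof (rule sum_mono)
    fix q assume "q \<in> Q"
    then obtain p j where q: "prime p" "j > 0" "q = p ^ j"
      by (auto simp: Q_def primepow_def)
    have f_q: "f q = p * q\<^sup>2"
      unfolding f_def q(3) aprimedivisor_prime_power[OF q(1,2)] ..
    also have "\<dots> = p ^ (2 * j + 1)"
      unfolding q(3) by (simp add: power_even_eq)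
    finally have "mangoldt (f q) = ln (real p)"
      using q(1) by (simp only: mangoldt_primepow) simp
    also have "\<dots> \<le> real p"
      using ln_le_minus_one[of "real p"] prime_gt_0_nat[OF q(1)] by simp
    finally have "mangoldt (f q) / real (f q) \<le> real p / real (f q)"
      by (rule divide_right_mono) simp
    also have "\<dots> = 1 / (real q)\<^sup>2"
      unfolding f_q using prime_gt_0_nat[OF q(1)] by simp
    finally show "mangoldt (f q) / real (f q) \<le> 1 / (real q)\<^sup>2" .
  qed
  also have "\<dots> \<le> (\<Sum>q\<in>{2..N}. 1 / (real q)\<^sup>2)"
    by (rule sum_mono2) (auto simp: Q_def)
  also have "\<dots> \<le> 1"
    by (rule sum_inverse_squares_le)
  finally show ?thesis .
qed

text \<open>
  The weight \<open>1 - chi4 n\<close> is \<open>2\<close> on the class \<open>3\<close>, \<open>0\<close> on the class \<open>1\<close> and \<open>1\<close> on the even numbers.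
  Summed against \<open>\<Lambda> n / n\<close> it yields \<open>ln N - ln M\<close> up to a bounded error, and the even numbers and the proper
  prime powers contribute a bounded amount. The constant is \<open>12 = (5 + 16 + 1 + 2 * 1) / 2\<close>: Mertens'
  estimate, the character sum, the even numbers, and twice the prime powers.
\<close>

lemma sum_ln_over_p_window_ge:
  assumes "0 < M" "M \<le> N"
  shows "(ln (real N) - ln (real M)) / 2 - 12
      \<le> (\<Sum>p | p \<in> {M<..N} \<and> prime p \<and> p mod 4 = 3. ln (real p) / real p)"
proof -
  define w :: "nat \<Rightarrow> real" where "w = (\<lambda>n. mangoldt n / real n)"
  have w: "w n \<ge> 0" for n
    by (simp add: w_def mangoldt_nonneg)
  have window: "(\<Sum>n\<in>{M<..N}. g n) = (\<Sum>n\<in>{1..N}. g n) - (\<Sum>n\<in>{1..M}. g n)" for g :: "nat \<Rightarrow> real"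
  proof -
    have "{1..N} = {1..M} \<union> {M<..N}"
      using assms by auto
    hence "(\<Sum>n\<in>{1..N}. g n) = (\<Sum>n\<in>{1..M}. g n) + (\<Sum>n\<in>{M<..N}. g n)"
      by (simp only:) (rule sum.union_disjoint, auto)
    thus ?thesis by simp
  qed
  have "ln (real N) - ln (real M) - 5 \<le> (\<Sum>n\<in>{M<..N}. w n)"
    using sum_mangoldt_over_n_bounds[of N] sum_mangoldt_over_n_bounds[of M] assms
    unfolding window w_def by linarith
  moreover have "(\<Sum>n\<in>{M<..N}. chi4 n * w n) \<le> 16"
    using abs_sum_chi4_mangoldt_over_n_le[of N] abs_sum_chi4_mangoldt_over_n_le[of M]
    unfolding window w_def times_divide_eq_right by linarith
  ultimately have "ln (real N) - ln (real M) - 21 \<le> (\<Sum>n\<in>{M<..N}. (1 - chi4 n) * w n)"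
    by (simp add: left_diff_distrib sum_subtractf)
  also have "\<dots> \<le> (\<Sum>n\<in>{M<..N}. (if even n then w n else 0)
      + 2 * (if n mod 4 = 3 \<and> \<not> prime n then w n else 0)
      + 2 * (if prime n \<and> n mod 4 = 3 then w n else 0))"
  proof (rule sum_mono)
    fix n :: nat
    have "n mod 4 = 1 \<or> n mod 4 = 3" if "odd n"
      using that by presburger
    thus "(1 - chi4 n) * w n \<le> (if even n then w n else 0)
      + 2 * (if n mod 4 = 3 \<and> \<not> prime n then w n else 0)
      + 2 * (if prime n \<and> n mod 4 = 3 then w n else 0)"
      using w[of n] by (cases "even n") (auto simp: chi4_def)
  qed
  also have "\<dots> = (\<Sum>n | n \<in> {M<..N} \<and> even n. w n)
      + 2 * (\<Sum>n | n \<in> {M<..N} \<and> n mod 4 = 3 \<and> \<not> prime n. w n)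
      + 2 * (\<Sum>p | p \<in> {M<..N} \<and> prime p \<and> p mod 4 = 3. w p)"
    by (simp add: sum.distrib sum_distrib_left[symmetric] sum.inter_filter[symmetric] Collect_conj_eq)
  finally have split: "ln (real N) - ln (real M) - 21
      \<le> (\<Sum>n | n \<in> {M<..N} \<and> even n. w n)
        + 2 * (\<Sum>n | n \<in> {M<..N} \<and> n mod 4 = 3 \<and> \<not> prime n. w n)
        + 2 * (\<Sum>p | p \<in> {M<..N} \<and> prime p \<and> p mod 4 = 3. w p)" .
  have "(\<Sum>n | n \<in> {M<..N} \<and> even n. w n) \<le> (\<Sum>n | n \<in> {1..N} \<and> even n. w n)"
    by (rule sum_mono2) (auto simp: w)
  hence even: "(\<Sum>n | n \<in> {M<..N} \<and> even n. w n) \<le> 1"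
    using sum_mangoldt_over_n_even_le[of N] unfolding w_def by linarith
  have "(\<Sum>n | n \<in> {M<..N} \<and> n mod 4 = 3 \<and> \<not> prime n. w n)
      \<le> (\<Sum>n | n \<in> {1..N} \<and> n mod 4 = 3 \<and> \<not> prime n. w n)"
    by (rule sum_mono2) (auto simp: w)
  hence powers: "(\<Sum>n | n \<in> {M<..N} \<and> n mod 4 = 3 \<and> \<not> prime n. w n) \<le> 1"
    using sum_mangoldt_over_n_odd_powers_le[of N] unfolding w_def by linarith
  have primes: "(\<Sum>p | p \<in> {M<..N} \<and> prime p \<and> p mod 4 = 3. w p)
      = (\<Sum>p | p \<in> {M<..N} \<and> prime p \<and> p mod 4 = 3. ln (real p) / real p)"
    by (intro sum.cong refl) (simp add: w_def)
  have "x / 2 - 12 \<le> s" if "x - 21 \<le> e + 2 * q + 2 * s" "e \<le> 1" "q \<le> 1" for x e q s :: real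
    using that by linarith
  from this[OF split even powers] show ?thesis
    unfolding primes .
qed

section \<open>Integers with a large prime factor congruent to three modulo four\<close>

lemma card_multiples:
  assumes "p > 0"
  shows "card {m \<in> {1..N}. p dvd m} = N div p"
proof -
  have "{m \<in> {1..N}. p dvd m} = (\<lambda>k. p * k) ` {1..N div p}"
    using assms by (auto simp: less_eq_div_iff_mult_less_eq mult.commute Suc_le_eq elim!: dvdE)
  moreover have "inj_on (\<lambda>k. p * k) {1..N div p}"
    using assms by (auto simp: inj_on_def)
  ultimately show ?thesis
    by (simp add: card_image)
qed

text \<open>
  With \<open>M\<close> the integer part of \<open>N powr (1 - \<delta>)\<close>, the sum of \<open>ln p / p\<close> over the window is at least
  \<open>\<delta> / 2 * ln N - 12\<close>. The lower bound on \<open>N\<close> is chosen such that \<open>12\<close> is at most half of the main term.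
  Dividing by \<open>ln N\<close> gives \<open>\<delta> / 4\<close> for the sum of \<open>1 / p\<close>, and rounding \<open>N / p\<close> down halves this once more.
\<close>

lemma card_M_set_ge:
  fixes \<delta> \<epsilon> :: real
  assumes \<delta>: "0 < \<delta>" "\<delta> \<le> 1 / 2" "\<delta> \<le> \<epsilon>" and N: "real N \<ge> exp (48 / \<delta>)"
  shows "\<delta> / 8 * real N \<le> real (card (M_set \<epsilon> \<inter> {1..N}))"
proof -
  have lnN: "ln (real N) \<ge> 48 / \<delta>"
    using N exp_gt_zero[of "48 / \<delta>"] by (subst ln_ge_iff) (auto simp del: exp_gt_zero)
  have "exp (48 / \<delta>) \<ge> 1"
    using \<delta> by simp
  hence N1: "real N \<ge> 1"
    using N by linarith
  define y where "y = real N powr (1 - \<delta>)"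
  define M where "M = nat \<lfloor>y\<rfloor>"
  define P where "P = {p. p \<in> {M<..N} \<and> prime p \<and> p mod 4 = 3}"
  have y: "1 \<le> y" "y \<le> real N"
    using powr_mono[of 0 "1 - \<delta>" "real N"] powr_mono[of "1 - \<delta>" 1 "real N"] \<delta> N1 by (auto simp: y_def)
  have M: "0 < M" "real M \<le> y" "M \<le> N"
    using y by (auto simp: M_def le_nat_iff le_floor_iff) linarith+
  have P_gt: "y < real p" if "p \<in> P" for p
    using that unfolding P_def M_def by (simp add: nat_less_iff floor_less_iff) linarith
  have fin: "finite P"
    by (auto simp: P_def)
  have "ln (real M) \<le> ln y"
    using M y by (subst ln_le_cancel_iff) auto
  also have "\<dots> = (1 - \<delta>) * ln (real N)"
    using N1 by (simp add: y_def ln_powr)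
  finally have "\<delta> * ln (real N) \<le> ln (real N) - ln (real M)"
    by (simp add: algebra_simps)
  moreover have "12 \<le> \<delta> / 4 * ln (real N)"
    using lnN \<delta> by (simp add: field_simps)
  ultimately have "\<delta> / 4 * ln (real N) \<le> (ln (real N) - ln (real M)) / 2 - 12"
    by (simp add: field_simps)
  also have "\<dots> \<le> (\<Sum>p\<in>P. ln (real p) / real p)"
    unfolding P_def by (intro sum_ln_over_p_window_ge M)
  also have "\<dots> \<le> (\<Sum>p\<in>P. ln (real N) * (1 / real p))"
  proof (rule sum_mono)
    fix p assume "p \<in> P"
    hence "0 < p" "p \<le> N"
      by (auto simp: P_def)
    thus "ln (real p) / real p \<le> ln (real N) * (1 / real p)"
      by (simp add: divide_right_mono)
  qed
  also have "\<dots> = ln (real N) * (\<Sum>p\<in>P. 1 / real p)"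
    by (rule sum_distrib_left[symmetric])
  finally have recip: "\<delta> / 4 \<le> (\<Sum>p\<in>P. 1 / real p)"
    using lnN \<delta> less_le_trans[of 0 "48 / \<delta>" "ln (real N)"] by (simp add: mult.commute)
  \<comment> \<open>This serves twice: no \<open>m \<le> N\<close> has two prime factors in \<open>P\<close>, and none is divisible by the square of one.\<close>
  have sq: "N < p * q" if "p \<in> P" "q \<in> P" for p q
  proof -
    have "real N = real N powr (1 / 2) * real N powr (1 / 2)"
      using N1 by (simp flip: powr_add)
    also have "\<dots> \<le> y * y"
      unfolding y_def using \<delta> N1 by (intro mult_mono powr_mono) auto
    also have "\<dots> < real p * real q"
      using P_gt[OF that(1)] P_gt[OF that(2)] y by (intro mult_strict_mono) auto
    finally show ?thesis
      by (simp flip: of_nat_mult)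
  qed
  have sub: "(\<Union>p\<in>P. {m \<in> {1..N}. p dvd m}) \<subseteq> M_set \<epsilon> \<inter> {1..N}"
  proof
    fix m assume "m \<in> (\<Union>p\<in>P. {m \<in> {1..N}. p dvd m})"
    then obtain p where p: "p \<in> P" "1 \<le> m" "m \<le> N" "p dvd m"
      by auto
    have "real m powr (1 - \<delta>) \<le> y"
      unfolding y_def using p \<delta> by (intro powr_mono2) auto
    hence "real m powr (1 - \<delta>) \<le> real p"
      using P_gt[OF p(1)] by linarith
    moreover have "m < p\<^sup>2"
      using sq[OF p(1) p(1)] p by (simp add: power2_eq_square)
    ultimately have "m \<in> M_set \<epsilon>"
      using p \<delta> by (intro mem_M_setI[of p m \<delta>]) (auto simp: P_def)
    thus "m \<in> M_set \<epsilon> \<inter> {1..N}"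
      using p by simp
  qed
  have disj: "{m \<in> {1..N}. p dvd m} \<inter> {m \<in> {1..N}. q dvd m} = {}"
    if "p \<in> P" "q \<in> P" "p \<noteq> q" for p q
  proof -
    have "coprime p q"
      using that by (intro primes_coprime) (auto simp: P_def)
    hence "p * q \<le> m" if "p dvd m" "q dvd m" "m \<ge> 1" for m
      using that by (intro dvd_imp_le divides_mult) auto
    thus ?thesis
      using sq[OF that(1,2)] by fastforce
  qed
  have "\<delta> / 8 * real N = real N / 2 * (\<delta> / 4)"
    by simp
  also have "\<dots> \<le> real N / 2 * (\<Sum>p\<in>P. 1 / real p)"
    by (intro mult_left_mono recip) auto
  also have "\<dots> \<le> (\<Sum>p\<in>P. real (N div p))"
    unfolding sum_distrib_left
  proof (rule sum_mono)
    fix p assume "p \<in> P"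
    hence p: "0 < p" "p \<le> N"
      by (auto simp: P_def)
    hence "1 \<le> N div p"
      by (simp add: Suc_le_eq div_greater_zero_iff)
    moreover have "N < p * (N div p + 1)"
      using p dividend_less_times_div[of p N] by simp
    moreover have "p * (N div p + 1) = p * (N div p) + p * 1"
      by (rule add_mult_distrib2)
    moreover have "p * 1 \<le> p * (N div p)"
      using \<open>1 \<le> N div p\<close> by (rule mult_le_mono2)
    ultimately have "N \<le> 2 * (p * (N div p))"
      by linarith
    hence "real N \<le> 2 * (real p * real (N div p))"
      by (metis of_nat_le_iff of_nat_mult of_nat_numeral)
    thus "real N / 2 * (1 / real p) \<le> real (N div p)"
      using p by (simp add: field_simps)
  qed
  also have "\<dots> = real (\<Sum>p\<in>P. card {m \<in> {1..N}. p dvd m})"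
    unfolding of_nat_sum
  proof (intro sum.cong refl)
    fix p assume "p \<in> P"
    hence "p > 0"
      by (auto simp: P_def prime_gt_0_nat)
    thus "real (N div p) = real (card {m \<in> {1..N}. p dvd m})"
      by (simp only: card_multiples)
  qed
  also have "(\<Sum>p\<in>P. card {m \<in> {1..N}. p dvd m}) = card (\<Union>p\<in>P. {m \<in> {1..N}. p dvd m})"
    using fin disj by (intro card_UN_disjoint[symmetric]) auto
  also have "real \<dots> \<le> real (card (M_set \<epsilon> \<inter> {1..N}))"
    using card_mono[OF _ sub] by simp
  finally show ?thesis .
qed

theorem theorem1p4:
  fixes \<epsilon> :: real
  assumes "\<epsilon> > 0"
  shows "lower_density (M_set \<epsilon>) > 0"
proof -
  \<comment> \<open>The cap at \<open>1 / 2\<close> keeps the multiples of different large primes disjoint.\<close>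
  define \<delta> where "\<delta> = min \<epsilon> (1 / 2)"
  have \<delta>: "0 < \<delta>" "\<delta> \<le> 1 / 2" "\<delta> \<le> \<epsilon>"
    using assms by (auto simp: \<delta>_def)
  have "\<forall>\<^sub>F N in sequentially. exp (48 / \<delta>) \<le> real N"
    using filterlim_real_sequentially by (auto simp: filterlim_at_top)
  hence "\<forall>\<^sub>F N in sequentially.
      ereal (\<delta> / 8) \<le> ereal (real (card (M_set \<epsilon> \<inter> {1..N})) / real N)"
  proof eventually_elim
    case (elim N)
    hence "0 < real N"
      using less_le_trans[OF exp_gt_zero] by blast
    thus ?case
      using card_M_set_ge[OF \<delta> elim] by (simp add: field_simps)
  qed
  hence "ereal (\<delta> / 8) \<le> lower_density (M_set \<epsilon>)"
    unfolding lower_density_def by (rule Liminf_bounded)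
  moreover have "0 < ereal (\<delta> / 8)"
    using \<delta> by simp
  ultimately show ?thesis
    by (rule less_le_trans[rotated])
qed

end
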